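(* Let $\mathbf v\in\mathbb C^N$ and $\mathbf M_0\in\mathbb H^N$ satisfy Assumption 1 (stated in the context). Then the following semidefinite programming (SDP) and second-order cone programming (SOCP) relaxations both recover the voltage vector $\mathbf v$. (SDP) minimize $\mathrm{Tr}(\mathbf M_0\mathbf X)$ over $\mathbf X\in\mathbb H^N$ subject to $X_{k,k}=|v_k|^2$ for all $k\in\mathcal N$, $\mathrm{Tr}(\mathbf Y_{l,p_f}\mathbf X)=p_{l,f}$ for all $l\in\mathcal L'$, and $\mathbf X\succeq\mathbf 0$. (SOCP) minimize $\mathrm{Tr}(\mathbf M_0\mathbf X)$ over $\mathbf X\in\mathbb H^N$ subject to $X_{k,k}=|v_k|^2$ for all $k\in\mathcal N$, $\mathrm{Tr}(\mathbf Y_{l,p_f}\mathbf X)=p_{l,f}$ for all $l\in\mathcal L'$, and $\begin{bmatrix} X_{s,s} & X_{s,t} \\ X_{t,s} & X_{t,t} \end{bmatrix}\succeq\mathbf 0$ for all $(s,t)\in\mathcal L'$. That is: $\mathbf X=\mathbf v\mathbf v^*$ is the unique solution of (SDP); and for every solution $\mathbf X^{\mathrm{opt}}$ of (SOCP), all entries of $\mathbf X^{\mathrm{opt}}-\mathbf v\mathbf v^*$ that lie on the diagonal or correspond to members of $\mathcal L'$ are equal to zero.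
   Context: $\mathbb H^N$ denotes the $N\times N$ complex Hermitian matrices, $(\cdot)^*$ the conjugate transpose (conjugate, for scalars), and $\measuredangle x$ the angle of a nonzero complex number $x$; angle differences are in degrees and understood modulo $360^\circ$. Network. $\mathcal G=(\mathcal N,\mathcal L)$ is the (connected) graph of a power network with bus set $\mathcal N=\{1,\dots,N\}$ and line set $\mathcal L$. $\mathcal G'=(\mathcal N,\mathcal L')$ is a subgraph of $\mathcal G$ containing a spanning tree of $\mathcal G$ (with at most one line between any two buses). Each line $l\in\mathcal L'$ is written $l=(s,t)$, where $s$ is its "from" end and $t$ its "to" end, and has branch admittance $y_{st}\in\mathbb C$. For $l=(s,t)\in\mathcal L'$, the matrix $\mathbf Y_{l,p_f}:=\frac12(\mathbf Y_f^*\mathbf d_l\mathbf e_s^\top+\mathbf e_s\mathbf d_l^\top\mathbf Y_f)\in\mathbb H^N$ (where $\mathbf Y_f$ is the "from" branch admittance matrix and $\mathbf d_l,\mathbf e_s$ are canonical vectors) has only the following possibly nonzero entries: $\mathbf Y_{l,p_f}(s,t)=\mathbf Y_{l,p_f}(t,s)^*=-y_{st}/2$ and $\mathbf Y_{l,p_f}(s,s)=\mathrm{Re}(y_{st})$. The active power entering line $l$ at its "from" end is $p_{l,f}=\mathrm{Tr}(\mathbf Y_{l,p_f}\mathbf v\mathbf v^* )$. The sparsity graph of a Hermitian matrix $\mathbf W\in\mathbb H^N$ is the simple undirected graph on $\{1,\dots,N\}$ in which distinct $i,j$ are adjacent iff $W_{i,j}\neq0$. Assumption 1. The edge set of the sparsity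 graph of $\mathbf M_0$ coincides with $\mathcal L'$, and, with $M_{0;st}$ denoting the $(s,t)$ entry of $\mathbf M_0$, for all $(s,t)\in\mathcal L'$: - $-180^\circ<\measuredangle M_{0;st}-\measuredangle y_{st}<0$; - $0<(\measuredangle v_s-\measuredangle v_t)-\measuredangle y_{st}<180^\circ$; - $(\measuredangle v_s-\measuredangle v_t)-\measuredangle M_{0;st}\neq 0$ or $180^\circ$ (i.e. it equals neither value). Equivalently: $\mathrm{Im}(M_{0;st}y_{st}^* )<0$, $\mathrm{Im}(v_sv_t^*y_{st}^* )>0$, $\mathrm{Im}(v_sv_t^*M_{0;st}^* )\ne0$. *)

theory Defs
  imports "HOL-Analysis.Analysis" "HOL-Library.Real_Mod" "Graph_Theory.Digraph_Component"
begin

section \<open>Complex matrices\<close>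

definition ctranspose :: "complex^'n^'m \<Rightarrow> complex^'m^'n" where
  "ctranspose A = (\<chi> i j. cnj (A $ j $ i))"

text \<open>The library's \<open>columnvector\<close> and \<open>rowvector\<close> leave the second dimension open; here it is 1.\<close>

abbreviation colvec :: "complex^'n \<Rightarrow> complex^1^'n" where
  "colvec u \<equiv> columnvector u"

abbreviation rowvec :: "complex^'n \<Rightarrow> complex^'n^1" where
  "rowvec u \<equiv> rowvector u"

definition hermitian :: "complex^'n^'n \<Rightarrow> bool" where
  "hermitian A \<longleftrightarrow> ctranspose A = A"

text \<open>For Hermitian \<open>A\<close> the form \<open>z* A z\<close> is real, so taking its real part loses nothing.\<close>

definition psd :: "complex^'n^'n \<Rightarrow> bool" where
  "psd A \<longleftrightarrow> hermitian A \<and>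
     (\<forall>z :: complex^'n. 0 \<le> Re ((ctranspose (colvec z) ** A ** colvec z) $ 1 $ 1))"

definition vvstar :: "complex^'n \<Rightarrow> complex^'n^'n" where
  "vvstar v = colvec v ** ctranspose (colvec v)"

definition submatrix2 :: "complex^'n^'n \<Rightarrow> 'n \<Rightarrow> 'n \<Rightarrow> complex^2^2" where
  "submatrix2 X s t = vector [vector [X $ s $ s, X $ s $ t], vector [X $ t $ s, X $ t $ t]]"

definition sparsity_edges :: "complex^'n^'n \<Rightarrow> 'n set set" where
  "sparsity_edges W = {{i, j} | i j. i \<noteq> j \<and> W $ i $ j \<noteq> 0}"

section \<open>Angles in degrees, modulo 360\<close>

text \<open>Meaningful for nonzero arguments only, since \<open>Arg 0 = 0\<close>.\<close>

definition angle_deg :: "complex \<Rightarrow> real" where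
  "angle_deg z = Arg z * 180 / pi"

definition angle_strictly_between :: "real \<Rightarrow> real \<Rightarrow> real \<Rightarrow> bool" where
  "angle_strictly_between lo \<theta> hi \<longleftrightarrow> (\<exists>\<phi>. [\<phi> = \<theta>] (rmod 360) \<and> lo < \<phi> \<and> \<phi> < hi)"

section \<open>The network\<close>

text \<open>
  A network is a digraph whose arcs are the lines; the tail and the head of an arc are the
  ``from'' and the ``to'' end of the line. The orientation is only a labelling of the ends, so
  connectedness and cycles are meant in the undirected sense. The library's \<open>connected\<close> is
  undirected, but its \<open>forest\<close> (hence \<open>tree\<close> and \<open>spanning_tree\<close>) excludes directed cycles only;
  hence the separate notions below. Parallel lines form a cycle of length 2.
\<close>

definition undirected_cycle :: "('n, 'l) pre_digraph \<Rightarrow> 'n list \<Rightarrow> 'l list \<Rightarrow> bool" where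
  "undirected_cycle G us ls \<longleftrightarrow>
     us \<noteq> [] \<and> length ls = length us \<and> distinct us \<and> distinct ls \<and> set ls \<subseteq> arcs G \<and>
     (\<forall>i < length us. {tail G (ls ! i), head G (ls ! i)} = {us ! i, us ! (Suc i mod length us)})"

definition undirected_spanning_tree ::
    "('n, 'l) pre_digraph \<Rightarrow> ('n, 'l) pre_digraph \<Rightarrow> bool" where
  "undirected_spanning_tree T G \<longleftrightarrow>
     spanning T G \<and> Digraph_Component.connected T \<and> (\<nexists>us ls. undirected_cycle T us ls)"

definition network_with_subgraph ::
    "('n, 'l) pre_digraph \<Rightarrow> ('n, 'l) pre_digraph \<Rightarrow> bool" where
  "network_with_subgraph G G' \<longleftrightarrow>
     verts G = UNIV \<and> Digraph_Component.connected G \<and>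
     spanning G' G \<and>
     (\<exists>T. undirected_spanning_tree T G \<and> subgraph T G') \<and>
     (\<forall>k \<in> arcs G'. \<forall>l \<in> arcs G'.
        {tail G' k, head G' k} = {tail G' l, head G' l} \<longrightarrow> k = l)"

section \<open>Line measurements\<close>

text \<open>
  \<open>Yf\<close> is the ``from'' branch admittance matrix, with one row per line. \<open>Ypf G Yf l\<close> is
  \<open>1/2 (Yf* d\<^sub>l e\<^sub>s\<^sup>T + e\<^sub>s d\<^sub>l\<^sup>T Yf)\<close>, where \<open>s\<close> is the ``from'' end of \<open>l\<close>.
\<close>

definition Ypf ::
    "('n::finite, 'l::finite) pre_digraph \<Rightarrow> complex^'n^'l \<Rightarrow> 'l \<Rightarrow> complex^'n^'n" where
  "Ypf G Yf l = (let d = axis l 1; e = axis (tail G l) 1 in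
     (1 / 2) *\<^sub>R (ctranspose Yf ** (colvec d ** rowvec e)
                + (colvec e ** rowvec d) ** Yf))"

text \<open>
  \<open>Yf\<close> is constrained only through the entries of \<open>Ypf\<close>, so the imaginary part of the diagonal
  term (e.g. a line-charging susceptance) is left free. Here \<open>y l\<close> is the branch
  admittance \<open>y\<^sub>s\<^sub>t\<close> of the line \<open>l = (s,t)\<close>.
\<close>

definition branch_admittances ::
    "('n::finite, 'l::finite) pre_digraph \<Rightarrow> ('l \<Rightarrow> complex) \<Rightarrow> complex^'n^'l \<Rightarrow> bool" where
  "branch_admittances G y Yf \<longleftrightarrow> (\<forall>l \<in> arcs G. let s = tail G l; t = head G l in
     Ypf G Yf l $ s $ t = - y l / 2 \<and>
     Ypf G Yf l $ t $ s = cnj (- y l / 2) \<and>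
     Ypf G Yf l $ s $ s = complex_of_real (Re (y l)) \<and>
     (\<forall>i j. (i, j) \<notin> {(s, t), (t, s), (s, s)} \<longrightarrow> Ypf G Yf l $ i $ j = 0))"

definition pf ::
    "('n::finite, 'l::finite) pre_digraph \<Rightarrow> complex^'n^'l \<Rightarrow> complex^'n \<Rightarrow> 'l \<Rightarrow> complex" where
  "pf G Yf v l = trace (Ypf G Yf l ** vvstar v)"

text \<open>The nonvanishing conditions make explicit that all the angles involved exist;
  \<open>M\<^sub>0\<^sub>;\<^sub>s\<^sub>t \<noteq> 0\<close> is already part of the sparsity condition.\<close>

definition assumption1 ::
    "('n::finite, 'l::finite) pre_digraph \<Rightarrow> ('l \<Rightarrow> complex) \<Rightarrow> complex^'n \<Rightarrow> complex^'n^'n \<Rightarrow> bool"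
  where
  "assumption1 G y v M0 \<longleftrightarrow>
     sparsity_edges M0 = {{tail G l, head G l} | l. l \<in> arcs G} \<and>
     (\<forall>l \<in> arcs G. let s = tail G l; t = head G l;
          vdiff = angle_deg (v $ s) - angle_deg (v $ t) in
        y l \<noteq> 0 \<and> v $ s \<noteq> 0 \<and> v $ t \<noteq> 0 \<and>
        angle_strictly_between (-180) (angle_deg (M0 $ s $ t) - angle_deg (y l)) 0 \<and>
        angle_strictly_between 0 (vdiff - angle_deg (y l)) 180 \<and>
        \<not> [vdiff - angle_deg (M0 $ s $ t) = 0] (rmod 360) \<and>
        \<not> [vdiff - angle_deg (M0 $ s $ t) = 180] (rmod 360))"

section \<open>The two relaxations\<close>

text \<open>Both arguments are Hermitian in all uses, so \<open>Tr (M0 X)\<close> is real.\<close>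

definition objective :: "complex^'n^'n \<Rightarrow> complex^'n^'n \<Rightarrow> real" where
  "objective M0 X = Re (trace (M0 ** X))"

definition measurement_constraints ::
    "('n::finite, 'l::finite) pre_digraph \<Rightarrow> complex^'n^'l \<Rightarrow> complex^'n \<Rightarrow> complex^'n^'n \<Rightarrow> bool"
  where
  "measurement_constraints G Yf v X \<longleftrightarrow>
     hermitian X \<and>
     (\<forall>k. X $ k $ k = complex_of_real ((cmod (v $ k))\<^sup>2)) \<and>
     (\<forall>l \<in> arcs G. trace (Ypf G Yf l ** X) = pf G Yf v l)"

definition SDP_feasible ::
    "('n::finite, 'l::finite) pre_digraph \<Rightarrow> complex^'n^'l \<Rightarrow> complex^'n \<Rightarrow> complex^'n^'n \<Rightarrow> bool"
  where
  "SDP_feasible G Yf v X \<longleftrightarrow> measurement_constraints G Yf v X \<and> psd X"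

definition SOCP_feasible ::
    "('n::finite, 'l::finite) pre_digraph \<Rightarrow> complex^'n^'l \<Rightarrow> complex^'n \<Rightarrow> complex^'n^'n \<Rightarrow> bool"
  where
  "SOCP_feasible G Yf v X \<longleftrightarrow> measurement_constraints G Yf v X \<and>
     (\<forall>l \<in> arcs G. psd (submatrix2 X (tail G l) (head G l)))"

definition SDP_solution where
  "SDP_solution G Yf v M0 X \<longleftrightarrow> is_arg_min (objective M0) (SDP_feasible G Yf v) X"

definition SOCP_solution where
  "SOCP_solution G Yf v M0 X \<longleftrightarrow> is_arg_min (objective M0) (SOCP_feasible G Yf v) X"

end

theory Submission
  imports Defs
begin

text \<open>
  Write \<open>D = X - v v*\<close> for the error of a feasible point \<open>X\<close>. The magnitude constraints make its
  diagonal vanish, and \<open>M0\<close> is supported on the diagonal and the lines, so the objective exceeds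
  its value at \<open>v v*\<close> by a sum over the lines of terms that each involve only the error on that
  line. The argument can therefore be made one line at a time, cycles included.

  On a line \<open>(s, t)\<close> put \<open>u = v\<^sub>s v\<^sub>t*\<close>, \<open>w = D\<^sub>s\<^sub>t\<close>, \<open>m = M\<^sub>0\<^sub>;\<^sub>s\<^sub>t\<close>. The power measurement fixes the
  real part of \<open>y* X\<^sub>s\<^sub>t\<close>, so \<open>w = \<i> \<tau> y\<close> for a real \<open>\<tau>\<close>: one real unknown per line remains.
  The two-by-two minor says \<open>|u + w| \<le> |u|\<close>; together with \<open>Im (u y*) > 0\<close> it forces \<open>\<tau> \<le> 0\<close>.
  The line contributes \<open>2 \<tau> Im (m y*)\<close> to the objective, and \<open>Im (m y*) < 0\<close>, so the contribution
  is nonnegative and vanishes only for \<open>\<tau> = 0\<close> (\<open>line_gap_nonneg_and_zero_iff\<close>). Hence \<open>v v*\<close> is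
  optimal for the second-order cone relaxation, and every optimum agrees with it on all lines.

  The feasible set of the semidefinite relaxation is smaller and still contains \<open>v v*\<close>, so its
  optima also agree with \<open>v v*\<close> on the diagonal and on the lines. Positive semidefiniteness then
  determines the other entries: where a two-by-two minor on a line is singular, its null vector,
  padded with zeros, is in the kernel of \<open>X\<close>, which makes the columns \<open>s\<close> and \<open>t\<close> of \<open>X\<close>
  proportional as they are in \<open>v v*\<close>. Following lines through the connected network, every column
  of \<open>X\<close> is the one of \<open>v v*\<close> (\<open>rank_one_completion\<close>).
\<close>

section \<open>From angle conditions to signs of imaginary parts\<close>

lemma rcis_mult_cnj: "rcis r \<alpha> * cnj (rcis s \<beta>) = rcis (r * s) (\<alpha> - \<beta>)"
  by (simp add: complex_eq_iff cos_diff sin_diff algebra_simps)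

lemma sin_degrees_rcong:
  assumes "[\<phi> = \<theta>] (rmod 360)"
  shows "sin (\<phi> * pi / 180) = sin (\<theta> * pi / 180)"
proof -
  obtain n where "\<theta> = \<phi> + of_int n * 360"
    using assms by (auto simp: rcong_altdef)
  then have "\<theta> * pi / 180 = \<phi> * pi / 180 + 2 * pi * of_int n"
    by (simp add: field_simps)
  then show ?thesis
    by (simp only: sin_add sin_int_2pin cos_int_2pin)
qed

lemma sin_degrees_pos:
  assumes "angle_strictly_between 0 \<theta> 180"
  shows "0 < sin (\<theta> * pi / 180)"
proof -
  obtain \<phi> where \<phi>: "[\<phi> = \<theta>] (rmod 360)" "0 < \<phi>" "\<phi> < 180"
    using assms by (auto simp: angle_strictly_between_def)
  have "0 < sin (\<phi> * pi / 180)"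
    using \<phi> by (intro sin_gt_zero) auto
  then show ?thesis
    by (simp only: sin_degrees_rcong [OF \<phi>(1)])
qed

lemma sin_degrees_neg:
  assumes "angle_strictly_between (-180) \<theta> 0"
  shows "sin (\<theta> * pi / 180) < 0"
proof -
  obtain \<phi> where \<phi>: "[\<phi> = \<theta>] (rmod 360)" "-180 < \<phi>" "\<phi> < 0"
    using assms by (auto simp: angle_strictly_between_def)
  have "angle_strictly_between 0 (- \<theta>) 180"
    unfolding angle_strictly_between_def
    using \<phi> by (intro exI [of _ "- \<phi>"]) simp
  then show ?thesis
    using sin_degrees_pos by fastforce
qed

lemma Im_mult_cnj_neg:
  assumes "a \<noteq> 0" "b \<noteq> 0"
    and "angle_strictly_between (-180) (angle_deg a - angle_deg b) 0"
  shows "Im (a * cnj b) < 0"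
proof -
  define \<delta> where "\<delta> = Arg a - Arg b"
  have "(angle_deg a - angle_deg b) * pi / 180 = \<delta>"
    by (simp add: angle_deg_def \<delta>_def field_simps)
  then have "sin \<delta> < 0"
    using sin_degrees_neg [OF assms(3)] by metis
  moreover have "a * cnj b = rcis (cmod a * cmod b) \<delta>"
    using rcis_mult_cnj [of "cmod a" "Arg a" "cmod b" "Arg b"]
    by (simp only: rcis_cmod_Arg \<delta>_def)
  ultimately show ?thesis
    using assms(1,2) by (simp add: mult_pos_neg del: times_complex.sel)
qed

lemma Im_mult_cnj_cnj_pos:
  assumes "a \<noteq> 0" "b \<noteq> 0" "c \<noteq> 0"
    and "angle_strictly_between 0 (angle_deg a - angle_deg b - angle_deg c) 180"
  shows "0 < Im (a * cnj b * cnj c)"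
proof -
  define \<delta> where "\<delta> = Arg a - Arg b - Arg c"
  have "(angle_deg a - angle_deg b - angle_deg c) * pi / 180 = \<delta>"
    by (simp add: angle_deg_def \<delta>_def field_simps)
  then have "0 < sin \<delta>"
    using sin_degrees_pos [OF assms(4)] by metis
  moreover have "a * cnj b * cnj c = rcis (cmod a * cmod b * cmod c) \<delta>"
    using rcis_mult_cnj [of "cmod a" "Arg a" "cmod b" "Arg b"]
      rcis_mult_cnj [of "cmod a * cmod b" "Arg a - Arg b" "cmod c" "Arg c"]
    by (simp only: rcis_cmod_Arg \<delta>_def)
  ultimately show ?thesis
    using assms(1-3) by (simp del: times_complex.sel)
qed

section \<open>The contribution of one line to the objective\<close>

text \<open>
  Here \<open>u\<close> is the true entry of the line, \<open>w\<close> its error, \<open>y\<close> the admittance and \<open>m\<close> the cost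
  coefficient. Geometrically, \<open>u + w\<close> lies on the line through \<open>u\<close> in direction \<open>\<i> y\<close> and in the
  closed disc around 0 that has \<open>u\<close> on its boundary. The condition on \<open>u\<close> says that \<open>\<i> y\<close> points out of
  this disc at \<open>u\<close>, the condition on \<open>m\<close> that the cost increases along \<open>- \<i> y\<close>.
\<close>
lemma line_gap_nonneg_and_zero_iff:
  fixes u w y m :: complex
  assumes power: "Re (cnj y * w) = 0"
    and bound: "cmod (u + w) \<le> cmod u"
    and u: "0 < Im (u * cnj y)"
    and m: "Im (m * cnj y) < 0"
  shows "0 \<le> Re (m * cnj w)" and "Re (m * cnj w) = 0 \<longleftrightarrow> w = 0"
proof -
  have y: "y \<noteq> 0" using m by auto
  define \<tau> where "\<tau> = Im (cnj y * w) / (cmod y)\<^sup>2"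
  (* cnj y * w is purely imaginary; multiplying by y, which turns cnj y into |y|^2, isolates w. *)
  have w: "w = \<i> * \<tau> * y"
  proof -
    have "cnj y * w = \<i> * Im (cnj y * w)"
      using power by (simp add: complex_eq_iff)
    then have "y * (cnj y * w) = \<i> * Im (cnj y * w) * y"
      by (metis mult.commute)
    then have "complex_of_real ((cmod y)\<^sup>2) * w = \<i> * Im (cnj y * w) * y"
      by (simp only: complex_norm_square mult.assoc)
    then show ?thesis
      using y by (simp add: \<tau>_def field_simps)
  qed
  have expand: "(cmod (u + w))\<^sup>2 = (cmod u)\<^sup>2 + \<tau>\<^sup>2 * (cmod y)\<^sup>2 + 2 * \<tau> * Im (u * cnj y)"
    unfolding w cmod_power2 by (simp add: power2_eq_square algebra_simps)
  have "(cmod (u + w))\<^sup>2 \<le> (cmod u)\<^sup>2"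
    using bound by (intro power_mono) auto
  then have le: "\<tau>\<^sup>2 * (cmod y)\<^sup>2 + 2 * \<tau> * Im (u * cnj y) \<le> 0"
    using expand by simp
  (* For \<tau> > 0 both summands below would be nonnegative, the second strictly positive. *)
  have "\<tau> \<le> 0"
  proof (rule ccontr)
    assume "\<not> \<tau> \<le> 0"
    then have "0 < 2 * \<tau> * Im (u * cnj y)" using u by simp
    moreover have "0 \<le> \<tau>\<^sup>2 * (cmod y)\<^sup>2" by simp
    ultimately show False using le by linarith
  qed
  moreover have gap: "Re (m * cnj w) = \<tau> * Im (m * cnj y)"
    by (simp add: w algebra_simps)
  ultimately show "0 \<le> Re (m * cnj w)"
    using m by (simp add: mult_nonpos_nonpos)
  show "Re (m * cnj w) = 0 \<longleftrightarrow> w = 0"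
    using gap m y by (auto simp: w)
qed

section \<open>Hermitian forms and positive semidefinite matrices\<close>

text \<open>
  The sesquilinear form whose diagonal values occur in \<open>psd\<close>; two arguments are needed to expand
  it at sums of vectors.
\<close>
definition herm_form :: "complex^'n^'n \<Rightarrow> complex^'n \<Rightarrow> complex^'n \<Rightarrow> complex" where
  "herm_form A z w = (\<Sum>i\<in>UNIV. cnj (z $ i) * (A *v w) $ i)"

lemma herm_form_add_left: "herm_form A (z + z') w = herm_form A z w + herm_form A z' w"
  by (simp add: herm_form_def algebra_simps sum.distrib)

lemma herm_form_add_right: "herm_form A z (w + w') = herm_form A z w + herm_form A z w'"
  by (simp add: herm_form_def algebra_simps sum.distrib matrix_vector_right_distrib)

lemma herm_form_scale_left: "herm_form A (c *s z) w = cnj c * herm_form A z w"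
  by (simp add: herm_form_def sum_distrib_left mult_ac)

lemma herm_form_scale_right: "herm_form A z (c *s w) = c * herm_form A z w"
  by (simp add: herm_form_def sum_distrib_left mult_ac vec.scale)

lemma herm_form_axis: "herm_form A (axis i a) (axis j b) = cnj a * A $ i $ j * b"
proof -
  have "herm_form A (axis i a) (axis j b) = (\<Sum>k\<in>UNIV. if k = i then cnj a * (A *v axis j b) $ i else 0)"
    unfolding herm_form_def by (intro sum.cong) (auto simp: axis_def)
  also have "\<dots> = cnj a * (A *v axis j b) $ i" by simp
  also have "(A *v axis j b) $ i = A $ i $ j * b"
    by (simp add: matrix_vector_mult_def axis_def if_distrib cong: if_cong)
  finally show ?thesis by simp
qed

lemma psd_iff_herm_form:
  "psd A \<longleftrightarrow> hermitian A \<and> (\<forall>z. 0 \<le> Re (herm_form A z z))"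
proof -
  have "(ctranspose (colvec z) ** A ** colvec z) $ 1 $ 1 = herm_form A z z" for z
    unfolding matrix_mul_assoc [symmetric]
    by (simp add: herm_form_def ctranspose_def columnvector_def matrix_matrix_mult_def
        matrix_vector_mult_def)
  then show ?thesis by (simp add: psd_def)
qed

lemma hermitian_entry: "hermitian A \<Longrightarrow> A $ j $ i = cnj (A $ i $ j)"
  unfolding hermitian_def ctranspose_def vec_eq_iff by simp

lemma herm_form_commute:
  assumes "hermitian A"
  shows "herm_form A w z = cnj (herm_form A z w)"
proof -
  have "herm_form A w z = (\<Sum>i\<in>UNIV. \<Sum>j\<in>UNIV. cnj (w $ i) * A $ i $ j * z $ j)"
    by (simp add: herm_form_def matrix_vector_mult_def sum_distrib_left mult.assoc)
  also have "\<dots> = (\<Sum>j\<in>UNIV. \<Sum>i\<in>UNIV. cnj (w $ i) * A $ i $ j * z $ j)"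
    by (rule sum.swap)
  also have "\<dots> = (\<Sum>j\<in>UNIV. \<Sum>i\<in>UNIV. cnj (cnj (z $ j) * (A $ j $ i * w $ i)))"
    by (intro sum.cong refl) (simp add: hermitian_entry [OF assms, symmetric] mult_ac)
  also have "\<dots> = cnj (herm_form A z w)"
    by (simp add: herm_form_def matrix_vector_mult_def sum_distrib_left)
  finally show ?thesis .
qed

text \<open>
  At an isotropic vector \<open>a\<close> the nonnegative form attains its minimum, so its derivative vanishes
  there in every direction. The direction \<open>b = A a\<close> suffices, because the derivative along it is
  \<open>2 |b|\<^sup>2\<close>.
\<close>
lemma psd_isotropic_imp_kernel:
  assumes A: "psd A" and a: "herm_form A a a = 0"
  shows "A *v a = 0"
proof -
  define b where "b = A *v a"
  define S where "S = (\<Sum>i\<in>UNIV. (cmod (b $ i))\<^sup>2)"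
  define \<beta> where "\<beta> = Re (herm_form A b b)"
  have herm: "hermitian A" and pos: "\<And>z. 0 \<le> Re (herm_form A z z)"
    using A by (auto simp: psd_iff_herm_form)
  have ba: "herm_form A b a = S"
    unfolding herm_form_def S_def b_def [symmetric] of_real_sum complex_norm_square
    by (simp add: mult.commute)
  have ab: "herm_form A a b = S"
    using herm_form_commute [OF herm, of a b] ba by simp
  have \<beta>: "0 \<le> \<beta>" by (simp add: \<beta>_def pos)
  have S: "0 \<le> S" by (simp add: S_def sum_nonneg)
  have quadratic: "0 \<le> - 2 * r * S + r\<^sup>2 * \<beta>" for r :: real
  proof -
    have "herm_form A (a + c *s b) (a + c *s b)
        = c * S + cnj c * S + cnj c * c * herm_form A b b" for c
      by (simp add: herm_form_add_left herm_form_add_right herm_form_scale_left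
          herm_form_scale_right a ab ba algebra_simps)
    from this [of "- of_real r"]
    have "Re (herm_form A (a + (- of_real r) *s b) (a + (- of_real r) *s b))
        = - 2 * r * S + r\<^sup>2 * \<beta>"
      by (simp only:) (simp add: \<beta>_def power2_eq_square)
    then show ?thesis using pos by metis
  qed
  have "S = 0"
  proof (rule ccontr)
    assume "S \<noteq> 0"
    with S have "0 < S" by simp
    (* Small enough for the linear term of the quadratic to outweigh the r^2 term;
       the 1 avoids dividing by 0. *)
    define r where "r = S / (\<beta> + 1)"
    have r: "0 < r" using \<open>0 < S\<close> \<beta> by (simp add: r_def)
    have "r * \<beta> < r * (\<beta> + 1)" using r by simp
    also have "\<dots> = S" using \<beta> by (simp add: r_def)
    finally have "r * (r * \<beta>) < r * S" using r by simp
    moreover have "0 < r * S" using r \<open>0 < S\<close> by simp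
    ultimately show False
      using quadratic [of r] by (simp add: power2_eq_square mult.assoc)
  qed
  then have "b = 0"
    by (simp add: S_def sum_nonneg_eq_0_iff vec_eq_iff)
  then show ?thesis by (simp add: b_def)
qed

lemma herm_form_two_axes:
  "herm_form A (axis i a + axis j b) (axis i a + axis j b)
    = cnj a * A $ i $ i * a + cnj a * A $ i $ j * b + cnj b * A $ j $ i * a + cnj b * A $ j $ j * b"
  by (simp add: herm_form_add_left herm_form_add_right herm_form_axis)

lemma submatrix2_entries:
  "submatrix2 X s t $ 1 $ 1 = X $ s $ s" "submatrix2 X s t $ 1 $ 2 = X $ s $ t"
  "submatrix2 X s t $ 2 $ 1 = X $ t $ s" "submatrix2 X s t $ 2 $ 2 = X $ t $ t"
  by (simp_all add: submatrix2_def)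

lemma herm_form_submatrix2:
  "herm_form (submatrix2 X s t) (axis 1 a + axis 2 b) (axis 1 a + axis 2 b)
    = herm_form X (axis s a + axis t b) (axis s a + axis t b)"
  by (simp only: herm_form_two_axes submatrix2_entries)

lemma psd_submatrix2:
  assumes "psd X"
  shows "psd (submatrix2 X s t)"
proof -
  have "hermitian (submatrix2 X s t)"
    using hermitian_entry [of X, symmetric] assms
    by (simp add: psd_def hermitian_def [of "submatrix2 X s t"] ctranspose_def vec_eq_iff
        forall_2 submatrix2_entries)
  moreover have "0 \<le> Re (herm_form (submatrix2 X s t) z z)" for z
  proof -
    obtain a b where z: "z = axis 1 a + axis 2 b"
    proof
      show "z = axis 1 (z $ 1) + axis 2 (z $ 2)"
        by (simp add: vec_eq_iff axis_def forall_2)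
    qed
    show ?thesis
      using assms unfolding z herm_form_submatrix2 psd_iff_herm_form by blast
  qed
  ultimately show ?thesis
    by (simp add: psd_iff_herm_form)
qed

text \<open>
  Testing the form on \<open>(- X\<^sub>s\<^sub>t, \<alpha>)\<close>, which eliminates the first coordinate, leaves \<open>\<alpha>\<close> times the
  determinant.
\<close>
lemma psd_submatrix2_minor:
  fixes X :: "complex^'n^'n"
  assumes psd: "psd (submatrix2 X s t)"
    and diag: "X $ s $ s = complex_of_real \<alpha>" "X $ t $ t = complex_of_real \<gamma>" and "0 < \<alpha>"
  shows "(cmod (X $ s $ t))\<^sup>2 \<le> \<alpha> * \<gamma>"
proof -
  define B where "B = X $ s $ t"
  have ts: "X $ t $ s = cnj B"
    using psd hermitian_entry [of "submatrix2 X s t" 2 1]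
    by (simp add: psd_iff_herm_form submatrix2_entries B_def)
  define z :: "complex^2" where "z = axis 1 (- B) + axis 2 (complex_of_real \<alpha>)"
  have BB: "complex_of_real ((cmod B)\<^sup>2) = B * cnj B"
    by (rule complex_norm_square)
  have "herm_form (submatrix2 X s t) z z = complex_of_real (\<alpha> * (\<alpha> * \<gamma> - (cmod B)\<^sup>2))"
    unfolding z_def herm_form_submatrix2
    unfolding herm_form_two_axes diag ts B_def [symmetric] of_real_mult of_real_diff BB
    by (simp add: algebra_simps)
  then have "0 \<le> \<alpha> * (\<alpha> * \<gamma> - (cmod B)\<^sup>2)"
    using psd by (metis Re_complex_of_real psd_iff_herm_form)
  then show ?thesis
    using \<open>0 < \<alpha>\<close> by (simp add: zero_le_mult_iff B_def)
qed

lemma vvstar_entry: "vvstar v $ i $ j = v $ i * cnj (v $ j)"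
  by (simp add: vvstar_def ctranspose_def columnvector_def matrix_matrix_mult_def)

lemma hermitian_vvstar: "hermitian (vvstar v)"
  by (simp add: hermitian_def ctranspose_def vec_eq_iff vvstar_entry)

lemma psd_vvstar: "psd (vvstar v)"
proof -
  have "herm_form (vvstar v) z z = complex_of_real ((cmod (\<Sum>i\<in>UNIV. cnj (v $ i) * z $ i))\<^sup>2)" for z
  proof -
    have "herm_form (vvstar v) z z
        = (\<Sum>i\<in>UNIV. v $ i * cnj (z $ i)) * (\<Sum>i\<in>UNIV. cnj (v $ i) * z $ i)"
      unfolding herm_form_def matrix_vector_mult_def sum_distrib_right
      by (intro sum.cong refl) (simp add: vvstar_entry sum_distrib_left mult_ac)
    also have "(\<Sum>i\<in>UNIV. v $ i * cnj (z $ i)) = cnj (\<Sum>i\<in>UNIV. cnj (v $ i) * z $ i)"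
      by simp
    finally show ?thesis
      by (simp only: complex_norm_square mult.commute)
  qed
  then show ?thesis
    by (simp add: psd_iff_herm_form hermitian_vvstar)
qed

section \<open>Completing a rank-one matrix along a connected graph\<close>

text \<open>
  If \<open>X\<close> agrees with \<open>v v*\<close> on the block \<open>{s, t}\<close>, this block annihilates \<open>(v\<^sub>t*, - v\<^sub>s*)\<close>. Padded
  with zeros this is an isotropic vector of \<open>X\<close>, hence in its kernel, and row \<open>k\<close> of the kernel
  equation yields \<open>X\<^sub>k\<^sub>t\<close> from \<open>X\<^sub>k\<^sub>s\<close>.
\<close>
lemma rank_one_propagates:
  assumes X: "psd X"
    and s: "X $ s $ s = vvstar v $ s $ s" and t: "X $ t $ t = vvstar v $ t $ t"
    and st: "X $ s $ t = vvstar v $ s $ t" "X $ t $ s = vvstar v $ t $ s"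
    and "v $ s \<noteq> 0" and ks: "X $ k $ s = vvstar v $ k $ s"
  shows "X $ k $ t = vvstar v $ k $ t"
proof -
  define a where "a = axis s (cnj (v $ t)) + axis t (- cnj (v $ s))"
  have "herm_form X a a = 0"
    unfolding a_def herm_form_two_axes by (simp add: s t st vvstar_entry)
  then have "X *v a = 0"
    by (rule psd_isotropic_imp_kernel [OF X])
  moreover have "(X *v a) $ k = X $ k $ s * cnj (v $ t) - X $ k $ t * cnj (v $ s)"
    by (simp add: a_def matrix_vector_right_distrib)
      (simp add: matrix_vector_mult_def axis_def if_distrib cong: if_cong)
  ultimately show ?thesis
    using \<open>v $ s \<noteq> 0\<close> ks by (simp add: vvstar_entry)
qed

lemma mk_symmetric_arcE:
  assumes "s \<rightarrow>\<^bsub>mk_symmetric T\<^esub> t"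
  obtains l where "l \<in> arcs T" "s = tail T l \<and> t = head T l \<or> s = head T l \<and> t = tail T l"
  using assms by (auto simp: parcs_mk_symmetric)

text \<open>
  In each row \<open>k\<close> the known diagonal entry \<open>(k, k)\<close> is carried along a path of lines from \<open>k\<close> to
  any other column.
\<close>
lemma rank_one_completion:
  fixes T :: "('n::finite, 'l) pre_digraph"
  assumes T: "Digraph_Component.connected T" "verts T = UNIV"
    and X: "psd X"
    and diag: "\<And>k. X $ k $ k = vvstar v $ k $ k"
    and line: "\<And>l. l \<in> arcs T \<Longrightarrow>
      X $ tail T l $ head T l = vvstar v $ tail T l $ head T l \<and>
      v $ tail T l \<noteq> 0 \<and> v $ head T l \<noteq> 0"
  shows "X = vvstar v"
proof -
  have wf: "wf_digraph (with_proj (mk_symmetric T))"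
    using T(2) by (simp add: wf_digraph_def)
  have herm: "hermitian X" using X by (simp add: psd_def)
  have line': "X $ head T l $ tail T l = vvstar v $ head T l $ tail T l" if "l \<in> arcs T" for l
    using line [OF that] hermitian_entry [OF herm, of "head T l" "tail T l"]
    by (simp add: vvstar_entry)
  have "X $ k $ j = vvstar v $ k $ j" for k j
  proof -
    have "k \<rightarrow>\<^sup>*\<^bsub>mk_symmetric T\<^esub> j"
      using T by (simp add: Digraph_Component.connected_def strongly_connected_def)
    then show ?thesis
    proof (induction rule: wf_digraph.reachable_induct [OF wf, consumes 1, case_names base step])
      case base
      show ?case by (rule diag)
    next
      case (step s t)
      from \<open>s \<rightarrow>\<^bsub>mk_symmetric T\<^esub> t\<close> obtain l where l: "l \<in> arcs T"
        and ends: "s = tail T l \<and> t = head T l \<or> s = head T l \<and> t = tail T l"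
        by (rule mk_symmetric_arcE)
      have "X $ s $ t = vvstar v $ s $ t" "X $ t $ s = vvstar v $ t $ s" "v $ s \<noteq> 0"
        using ends by (auto simp: line [OF l] line' [OF l])
      from rank_one_propagates [OF X diag diag this step.IH] show ?case .
    qed
  qed
  then show ?thesis by (simp add: vec_eq_iff)
qed

section \<open>Exactness of the relaxations\<close>

lemma trace_mult: "trace (A ** B) = (\<Sum>i\<in>UNIV. \<Sum>j\<in>UNIV. A $ i $ j * B $ j $ i)"
  by (simp add: trace_def matrix_matrix_mult_def)

text \<open>
  Every line is an edge of the sparsity graph of \<open>M0\<close>, and those edges join distinct vertices.
\<close>
lemma no_loop_of_assumption1:
  assumes "assumption1 G y v M0" "l \<in> arcs G"
  shows "tail G l \<noteq> head G l"
proof -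
  have "{tail G l, head G l} \<in> sparsity_edges M0"
    using assms by (auto simp: assumption1_def)
  then show ?thesis
    by (auto simp: sparsity_edges_def doubleton_eq_iff)
qed

lemma M0_entry_nonzero_of_assumption1:
  assumes "assumption1 G y v M0" "hermitian M0" "l \<in> arcs G"
  shows "M0 $ tail G l $ head G l \<noteq> 0"
proof -
  have "{tail G l, head G l} \<in> sparsity_edges M0"
    using assms by (auto simp: assumption1_def)
  then show ?thesis
    using hermitian_entry [OF assms(2), of "tail G l" "head G l"]
    by (auto simp: sparsity_edges_def doubleton_eq_iff)
qed

text \<open>
  The measurement of \<open>X\<close> minus the one of \<open>v v*\<close> is linear in the error, whose \<open>(s, s)\<close> entry
  vanishes. The remaining two entries of the measurement matrix are conjugate, so they measure a
  real part.
\<close>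
lemma measured_power_determines_real_part:
  assumes Y: "branch_admittances G y Yf" and l: "l \<in> arcs G" "tail G l = s" "head G l = t" "s \<noteq> t"
    and X: "measurement_constraints G Yf v X"
  shows "Re (cnj (y l) * ((X - vvstar v) $ s $ t)) = 0"
proof -
  define D where "D = X - vvstar v"
  define A where "A = Ypf G Yf l"
  have A: "A $ s $ t = - y l / 2" "A $ t $ s = cnj (- y l / 2)"
    "\<And>i j. (i, j) \<notin> {(s, t), (t, s), (s, s)} \<Longrightarrow> A $ i $ j = 0"
    using Y l by (auto simp: branch_admittances_def A_def Let_def)
  have ss: "D $ s $ s = 0"
    using X unfolding measurement_constraints_def D_def by (simp add: vvstar_entry flip: complex_norm_square)
  have ts: "D $ t $ s = cnj (D $ s $ t)"
    using X hermitian_entry [of X t s] by (simp add: measurement_constraints_def D_def vvstar_entry)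
  have "0 = trace (A ** X) - trace (A ** vvstar v)"
    using X l by (simp add: measurement_constraints_def pf_def A_def)
  also have "\<dots> = trace (A ** D)"
    by (simp add: trace_mult D_def right_diff_distrib sum_subtractf)
  also have "\<dots> = (\<Sum>(i, j)\<in>UNIV \<times> UNIV. A $ i $ j * D $ j $ i)"
    by (simp add: trace_mult sum.cartesian_product)
  also have "\<dots> = (\<Sum>(i, j)\<in>{(s, t), (t, s), (s, s)}. A $ i $ j * D $ j $ i)"
    by (intro sum.mono_neutral_right) (use A(3) in \<open>simp_all, fastforce\<close>)
  also have "\<dots> = - (y l * cnj (D $ s $ t) + cnj (y l) * D $ s $ t) / 2"
    using l by (simp add: A ss ts field_simps)
  finally have "0 = - (y l * cnj (D $ s $ t) + cnj (y l) * D $ s $ t) / 2" .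
  from arg_cong [OF this, of Re] have "Re (cnj (y l) * (D $ s $ t)) = 0"
    by simp
  then show ?thesis by (simp only: D_def)
qed

lemma SDP_feasible_imp_SOCP_feasible: "SDP_feasible G Yf v X \<Longrightarrow> SOCP_feasible G Yf v X"
  by (simp add: SDP_feasible_def SOCP_feasible_def psd_submatrix2)

lemma SDP_feasible_vvstar: "SDP_feasible G Yf v (vvstar v)"
  by (simp add: SDP_feasible_def measurement_constraints_def hermitian_vvstar psd_vvstar pf_def
      vvstar_entry flip: complex_norm_square)

lemma SOCP_feasible_vvstar: "SOCP_feasible G Yf v (vvstar v)"
  by (intro SDP_feasible_imp_SOCP_feasible SDP_feasible_vvstar)

context
  fixes G :: "('n::finite, 'l::finite) pre_digraph"
    and y :: "'l \<Rightarrow> complex" and Yf :: "complex^'n^'l" and v :: "complex^'n"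
    and M0 :: "complex^'n^'n" and X :: "complex^'n^'n"
  assumes Y: "branch_admittances G y Yf"
    and M0: "hermitian M0"
    and assm1: "assumption1 G y v M0"
    and X: "SOCP_feasible G Yf v X"
begin

lemma hermitian_error: "hermitian (X - vvstar v)"
  using X hermitian_vvstar [of v]
  by (simp add: SOCP_feasible_def measurement_constraints_def hermitian_def ctranspose_def vec_eq_iff)

lemma diagonal_exact: "(X - vvstar v) $ k $ k = 0"
  using X by (simp add: SOCP_feasible_def measurement_constraints_def vvstar_entry
      flip: complex_norm_square)

lemma line_gap:
  assumes l: "l \<in> arcs G"
  defines "s \<equiv> tail G l" and "t \<equiv> head G l"
  shows "0 \<le> Re (M0 $ s $ t * cnj ((X - vvstar v) $ s $ t))"
    and "Re (M0 $ s $ t * cnj ((X - vvstar v) $ s $ t)) = 0 \<longleftrightarrow> (X - vvstar v) $ s $ t = 0"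
proof -
  define w where "w = (X - vvstar v) $ s $ t"
  define u where "u = v $ s * cnj (v $ t)"
  have st: "s \<noteq> t"
    using no_loop_of_assumption1 [OF assm1 l] by (simp add: s_def t_def)
  have nz: "M0 $ s $ t \<noteq> 0"
    using M0_entry_nonzero_of_assumption1 [OF assm1 M0 l] by (simp add: s_def t_def)
  have angles: "y l \<noteq> 0" "v $ s \<noteq> 0" "v $ t \<noteq> 0"
    "angle_strictly_between (-180) (angle_deg (M0 $ s $ t) - angle_deg (y l)) 0"
    "angle_strictly_between 0 (angle_deg (v $ s) - angle_deg (v $ t) - angle_deg (y l)) 180"
    using assm1 l by (auto simp: assumption1_def Let_def s_def t_def)
  have power: "Re (cnj (y l) * w) = 0"
    using measured_power_determines_real_part [OF Y l _ _ st] X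
    by (simp add: SOCP_feasible_def w_def s_def t_def)
  have "(cmod (u + w))\<^sup>2 = (cmod (X $ s $ t))\<^sup>2"
    by (simp add: u_def w_def vvstar_entry)
  also have "\<dots> \<le> (cmod (v $ s))\<^sup>2 * (cmod (v $ t))\<^sup>2"
    using X l angles
    by (intro psd_submatrix2_minor)
      (auto simp: SOCP_feasible_def measurement_constraints_def s_def t_def)
  also have "\<dots> = (cmod u)\<^sup>2"
    by (simp add: u_def norm_mult power_mult_distrib)
  finally have bound: "cmod (u + w) \<le> cmod u"
    by (rule power2_le_imp_le) simp
  have u: "0 < Im (u * cnj (y l))"
    unfolding u_def using angles by (intro Im_mult_cnj_cnj_pos)
  have m: "Im (M0 $ s $ t * cnj (y l)) < 0"
    using angles nz by (intro Im_mult_cnj_neg)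
  show "0 \<le> Re (M0 $ s $ t * cnj ((X - vvstar v) $ s $ t))"
    "Re (M0 $ s $ t * cnj ((X - vvstar v) $ s $ t)) = 0 \<longleftrightarrow> (X - vvstar v) $ s $ t = 0"
    using line_gap_nonneg_and_zero_iff [OF power bound u m] by (simp_all only: w_def)
qed

text \<open>
  The objective gap is summed over ordered pairs of buses, so every line contributes twice, as
  \<open>(s, t)\<close> and as \<open>(t, s)\<close>. The two terms are conjugate, so they have the same real part. Bounding
  each term separately avoids re-indexing the sum by lines.
\<close>
lemma objective_term_nonneg: "0 \<le> Re (M0 $ i $ j * (X - vvstar v) $ j $ i)"
proof (cases "i = j \<or> M0 $ i $ j = 0")
  case True
  then show ?thesis
    using diagonal_exact by auto
next
  case False
  then have "{i, j} \<in> sparsity_edges M0"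
    by (auto simp: sparsity_edges_def)
  then obtain l where l: "l \<in> arcs G" "{i, j} = {tail G l, head G l}"
    using assm1 by (auto simp: assumption1_def)
  define D where "D = X - vvstar v"
  have D: "D $ j $ i = cnj (D $ i $ j)"
    unfolding D_def by (rule hermitian_entry [OF hermitian_error])
  have M: "M0 $ j $ i = cnj (M0 $ i $ j)"
    by (rule hermitian_entry [OF M0])
  from l(2) consider "i = tail G l" "j = head G l" | "j = tail G l" "i = head G l"
    by (auto simp: doubleton_eq_iff)
  then have "0 \<le> Re (M0 $ i $ j * D $ j $ i)"
  proof cases
    case 1
    then show ?thesis
      using line_gap(1) [OF l(1)] D by (simp flip: D_def)
  next
    case 2
    then show ?thesis
      using line_gap(1) [OF l(1)] D M by (simp flip: D_def)
  qed
  then show ?thesis by (simp add: D_def)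
qed

lemma objective_gap:
  "objective M0 X - objective M0 (vvstar v)
    = (\<Sum>i\<in>UNIV. \<Sum>j\<in>UNIV. Re (M0 $ i $ j * (X - vvstar v) $ j $ i))"
  by (simp only: objective_def trace_mult Re_sum vector_minus_component right_diff_distrib
      minus_complex.sel sum_subtractf)

lemma objective_vvstar_le: "objective M0 (vvstar v) \<le> objective M0 X"
proof -
  have "0 \<le> objective M0 X - objective M0 (vvstar v)"
    unfolding objective_gap by (intro sum_nonneg objective_term_nonneg)
  then show ?thesis by simp
qed

lemma line_exact_if_objective_le:
  assumes le: "objective M0 X \<le> objective M0 (vvstar v)" and l: "l \<in> arcs G"
  shows "(X - vvstar v) $ tail G l $ head G l = 0"
proof -
  have "(\<Sum>i\<in>UNIV. \<Sum>j\<in>UNIV. Re (M0 $ i $ j * (X - vvstar v) $ j $ i)) = 0"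
    using le objective_vvstar_le unfolding objective_gap [symmetric] by (intro antisym) simp_all
  then have "Re (M0 $ i $ j * (X - vvstar v) $ j $ i) = 0" for i j
    using objective_term_nonneg by (simp add: sum_nonneg_eq_0_iff sum_nonneg del: times_complex.sel)
  then have "Re (M0 $ tail G l $ head G l * (X - vvstar v) $ head G l $ tail G l) = 0"
    by blast
  then show ?thesis
    using line_gap(2) [OF l] hermitian_entry [OF hermitian_error, of "head G l" "tail G l"]
    by metis
qed

end

theorem theorem1:
  fixes G G' :: "('n::finite, 'l::finite) pre_digraph"
    and y :: "'l \<Rightarrow> complex"
    and Yf :: "complex^'n^'l"
    and v :: "complex^'n"
    and M0 :: "complex^'n^'n"
  assumes "network_with_subgraph G G'"
    and "branch_admittances G' y Yf"
    and "hermitian M0"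
    and "assumption1 G' y v M0"
  shows "(\<forall>X. SDP_solution G' Yf v M0 X \<longleftrightarrow> X = vvstar v) \<and>
         (\<forall>X. SOCP_solution G' Yf v M0 X \<longrightarrow>
            (\<forall>k. (X - vvstar v) $ k $ k = 0) \<and>
            (\<forall>l \<in> arcs G'. (X - vvstar v) $ tail G' l $ head G' l = 0 \<and>
                            (X - vvstar v) $ head G' l $ tail G' l = 0))"
proof -
  note optimal = objective_vvstar_le [OF assms(2-4)]
  note exact = line_exact_if_objective_le [OF assms(2-4)]
  obtain T where T: "Digraph_Component.connected T" "verts T = UNIV" "subgraph T G'"
    using assms(1)
    by (auto simp: network_with_subgraph_def undirected_spanning_tree_def spanning_def)
  have T_arcs: "l \<in> arcs G' \<and> tail T l = tail G' l \<and> head T l = head G' l" if "l \<in> arcs T" for l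
    using T(3) that by (auto simp: subgraph_def compatible_def)
  have SDP_unique: "X = vvstar v" if "SDP_solution G' Yf v M0 X" for X
  proof -
    have X: "psd X" "SOCP_feasible G' Yf v X"
      using that by (auto simp: SDP_solution_def is_arg_min_def SDP_feasible_def
          intro: SDP_feasible_imp_SOCP_feasible)
    have le: "objective M0 X \<le> objective M0 (vvstar v)"
      using that SDP_feasible_vvstar [of G' Yf v]
      by (auto simp: SDP_solution_def is_arg_min_def not_less)
    show ?thesis
    proof (rule rank_one_completion [OF T(1,2) X(1)])
      show "X $ k $ k = vvstar v $ k $ k" for k
        using diagonal_exact [OF assms(2-4) X(2), of k] by simp
      fix l assume "l \<in> arcs T"
      note l = T_arcs [OF this]
      then show "X $ tail T l $ head T l = vvstar v $ tail T l $ head T l \<and>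
          v $ tail T l \<noteq> 0 \<and> v $ head T l \<noteq> 0"
        using exact [OF X(2) le, of l] assms(4) by (auto simp: assumption1_def Let_def)
    qed
  qed
  have SDP_optimal: "SDP_solution G' Yf v M0 (vvstar v)"
    using optimal SDP_feasible_imp_SOCP_feasible SDP_feasible_vvstar
    by (fastforce simp: SDP_solution_def is_arg_min_def not_less)
  have SOCP_exact: "(X - vvstar v) $ k $ k = 0"
    "l \<in> arcs G' \<Longrightarrow> (X - vvstar v) $ tail G' l $ head G' l = 0"
    "l \<in> arcs G' \<Longrightarrow> (X - vvstar v) $ head G' l $ tail G' l = 0"
    if "SOCP_solution G' Yf v M0 X" for X k l
  proof -
    have X: "SOCP_feasible G' Yf v X"
      using that by (simp add: SOCP_solution_def is_arg_min_def)
    have le: "objective M0 X \<le> objective M0 (vvstar v)"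
      using that SOCP_feasible_vvstar [of G' Yf v]
      by (auto simp: SOCP_solution_def is_arg_min_def not_less)
    show "(X - vvstar v) $ k $ k = 0"
      by (rule diagonal_exact [OF assms(2-4) X])
    assume l: "l \<in> arcs G'"
    show st: "(X - vvstar v) $ tail G' l $ head G' l = 0"
      by (rule exact [OF X le l])
    show "(X - vvstar v) $ head G' l $ tail G' l = 0"
      using hermitian_entry [OF hermitian_error [OF assms(2-4) X], of "head G' l" "tail G' l"] st
      by simp
  qed
  show ?thesis
    using SDP_unique SDP_optimal SOCP_exact by blast
qed

end
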